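(* Suppose that the error bound $$\|x_\alpha^\delta-x^\dagger\|_X\le\varphi(\alpha)+\frac{\delta}{\lambda(\alpha)}\qquad(\alpha>0,\ 0<\delta\le\delta_0)$$ holds, where $\varphi$ is an index function and $\lambda(\alpha)=\alpha^{\varkappa}/K_2$ with $\varkappa>0$, $K_2>0$. For each $\delta\in(0,\delta_0]$ let $\Delta_\delta=\{\alpha_0<\alpha_1<\dots<\alpha_N\}$ with $\alpha_j=q^j\alpha_0$ ($0\le j\le N$), where $q>1$ does not depend on $\delta$ while $\alpha_0$ and $N\ge0$ may depend on $\delta$, and assume $$0<\alpha_0\le c_5\,\delta^{1/\varkappa},\qquad c_6\le\alpha_N\le c_7,$$ with constants $c_5,c_6,c_7>0$ independent of $\delta$. Let the balancing constant $\tau_L$ satisfy $\tau_L>1+q^{-\varkappa}$, and let $$H_\delta:=\Big\{\alpha_k\in\Delta_\delta:\ \|x_{\alpha_j}^\delta-x_{\alpha_{j-1}}^\delta\|_X\le\tau_L\frac{\delta}{\lambda(\alpha_{j-1})}\ \text{ for all }1\le j\le k\Big\}.$$ Then the parameter choice $\alpha_*=\max H_\delta$ is quasi-optimal, i.e. there is a constant $c_2>0$, independent of $\delta$ (but possibly depending on $\varphi$), such that for all $0<\delta\le\delta_0$ $$\|x_{\alpha_*}^\delta-x^\dagger\|_X\le c_2\inf_{\alpha>0}\Big(\varphi(\alpha)+\frac{\delta}{\lambda(\alpha)}\Big).$$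
   Context: $X,Y$ are Hilbert spaces, $x^\dagger\in X$ is fixed, $\delta_0>0$, and for each $0<\delta\le\delta_0$ a datum $y^\delta\in Y$ is given together with elements $x_\alpha^\delta=R_\alpha(y^\delta)\in X$ for $\alpha>0$, produced by some regularization scheme $R_\alpha$ that is not further specified. No property of an underlying operator or of the noise is used other than the error bound in the statement. An index function is a continuous non-decreasing function $\varphi:(0,\infty)\to(0,\infty)$ with $\lim_{t\to+0}\varphi(t)=0$. The condition defining $H_\delta$ is vacuous for $k=0$, so $\alpha_0\in H_\delta$. *)

theory Defs
  imports "HOL-Analysis.Analysis"
begin

text \<open>Functions on the half-line of positive reals are represented by total functions on the reals;
  only their values at positive arguments are constrained or used.\<close>

definition index_function :: "(real \<Rightarrow> real) \<Rightarrow> bool" where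
  "index_function \<phi> \<longleftrightarrow>
     (\<forall>t>0. \<phi> t > 0) \<and> continuous_on {0<..} \<phi> \<and> mono_on {0<..} \<phi> \<and> (\<phi> \<longlongrightarrow> 0) (at_right 0)"

definition grid_point :: "real \<Rightarrow> real \<Rightarrow> nat \<Rightarrow> real" where
  "grid_point q \<alpha>\<^sub>0 j = q ^ j * \<alpha>\<^sub>0"

text \<open>The map \<open>x\<close> sends a regularization parameter to the approximation computed from the datum at
  noise level \<open>\<delta>\<close>. Only the instances with \<open>j \<ge> 1\<close> occur, so \<open>j - 1\<close> is never truncated.\<close>

definition balancing_set ::
  "real \<Rightarrow> (real \<Rightarrow> real) \<Rightarrow> real \<Rightarrow> (real \<Rightarrow> 'x::real_normed_vector) \<Rightarrow> real \<Rightarrow> real \<Rightarrow> nat \<Rightarrow> real set"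
  where
  "balancing_set \<tau> lam \<delta> x q \<alpha>\<^sub>0 N =
     {grid_point q \<alpha>\<^sub>0 k | k. k \<le> N \<and>
        (\<forall>j\<in>{1..k}. norm (x (grid_point q \<alpha>\<^sub>0 j) - x (grid_point q \<alpha>\<^sub>0 (j - 1)))
                      \<le> \<tau> * (\<delta> / lam (grid_point q \<alpha>\<^sub>0 (j - 1))))}"

text \<open>The balancing set always contains the smallest grid point, so that its maximum is meaningful.\<close>

lemma finite_balancing_set: "finite (balancing_set \<tau> lam \<delta> x q \<alpha>\<^sub>0 N)"
  by (rule finite_subset[of _ "grid_point q \<alpha>\<^sub>0 ` {..N}"]) (auto simp: balancing_set_def)

lemma first_in_balancing_set: "\<alpha>\<^sub>0 \<in> balancing_set \<tau> lam \<delta> x q \<alpha>\<^sub>0 N"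
  unfolding balancing_set_def by (rule CollectI, rule exI[of _ 0]) (auto simp: grid_point_def)

lemma Max_balancing_set_in:
  "Max (balancing_set \<tau> lam \<delta> x q \<alpha>\<^sub>0 N) \<in> balancing_set \<tau> lam \<delta> x q \<alpha>\<^sub>0 N"
  using finite_balancing_set first_in_balancing_set by (metis Max_in empty_iff)

end

theory Submission
  imports Defs
begin

text \<open>Write \<open>s \<alpha> = \<delta> / \<lambda>(\<alpha>)\<close> and \<open>p = q\<^sup>-\<^sup>\<kappa> < 1\<close>, so that \<open>s\<close> shrinks by the factor \<open>p\<close> along the grid,
  and let \<open>\<alpha>\<^sub>K\<close> be the chosen parameter. Telescoping gives, for every \<open>j \<le> K\<close>, the error bound
  \<open>\<phi>(\<alpha>\<^sub>j) + (1 + \<tau>/(1 - p)) s(\<alpha>\<^sub>j)\<close>; comparing with a given \<open>\<alpha> \<le> \<alpha>\<^sub>K\<close> one takes the largest grid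
  point below \<open>\<alpha>\<close>, or \<open>\<alpha>\<^sub>0\<close> if there is none, in which case \<open>s(\<alpha>) \<ge> s(\<alpha>\<^sub>0)\<close> is bounded below because
  \<open>\<alpha>\<^sub>0 = O(\<delta>\<^sup>1\<^sup>/\<^sup>\<kappa>)\<close>. For \<open>\<alpha> \<ge> \<alpha>\<^sub>K\<close> it remains to control \<open>s(\<alpha>\<^sub>K)\<close> by \<open>\<phi> + s\<close>: if \<open>K < N\<close>, the failing
  test at \<open>K + 1\<close> forces \<open>2 \<phi>(\<alpha>\<^sub>K\<^sub>+\<^sub>1) > (\<tau> - 1 - p) s(\<alpha>\<^sub>K)\<close>, and if \<open>K = N\<close>, then \<open>s(\<alpha>\<^sub>K) = O(\<delta>)\<close>, which no
  \<open>\<phi> + s\<close> can beat.\<close>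

lemma grid_point_0 [simp]: "grid_point q a 0 = a"
  and grid_point_Suc: "grid_point q a (Suc j) = q * grid_point q a j"
  by (simp_all add: grid_point_def)

lemma grid_point_pos: "q > 0 \<Longrightarrow> a > 0 \<Longrightarrow> grid_point q a j > 0"
  by (simp add: grid_point_def)

lemma grid_point_le_iff:
  assumes "q > 1" "a > 0"
  shows "grid_point q a i \<le> grid_point q a j \<longleftrightarrow> i \<le> j"
  using assms by (simp add: grid_point_def)

text \<open>The tests are cumulative, so the balancing set is an initial segment of the grid. If the
  test at \<open>Suc K\<close> passed as well, \<open>grid_point q a (Suc K)\<close> would belong to
  the set and exceed its maximum. For \<open>K = N\<close> no such grid point is left, so nothing is
  known about a failing test.\<close>

lemma balancing_index_exists:
  assumes q: "q > 1" and a: "a > 0"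
  obtains K where "K \<le> N"
    and "Max (balancing_set \<tau> lam \<delta> x q a N) = grid_point q a K"
    and "\<And>j. j < K \<Longrightarrow> norm (x (grid_point q a (Suc j)) - x (grid_point q a j))
           \<le> \<tau> * (\<delta> / lam (grid_point q a j))"
    and "K < N \<Longrightarrow> norm (x (grid_point q a (Suc K)) - x (grid_point q a K))
           > \<tau> * (\<delta> / lam (grid_point q a K))"
proof -
  let ?H = "balancing_set \<tau> lam \<delta> x q a N"
  let ?T = "\<lambda>j. norm (x (grid_point q a j) - x (grid_point q a (j - 1)))
                  \<le> \<tau> * (\<delta> / lam (grid_point q a (j - 1)))"
  obtain K where K: "K \<le> N" "Max ?H = grid_point q a K" and T: "\<forall>j\<in>{1..K}. ?T j"
    using Max_balancing_set_in[of \<tau> lam \<delta> x q a N] unfolding balancing_set_def by auto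
  have "\<not> ?T (Suc K)" if "K < N"
  proof
    assume "?T (Suc K)"
    with T have "\<forall>j\<in>{1..Suc K}. ?T j"
      by (metis atLeastAtMost_iff le_SucE)
    then have "grid_point q a (Suc K) \<in> ?H"
      using that unfolding balancing_set_def by (intro CollectI exI[of _ "Suc K"]) auto
    then have "grid_point q a (Suc K) \<le> grid_point q a K"
      using Max_ge[OF finite_balancing_set] K(2) by metis
    then show False
      using grid_point_le_iff[OF q a] by simp
  qed
  moreover have "?T (Suc j)" if "j < K" for j
    using T that by (metis atLeastAtMost_iff Suc_leI le_add1 plus_1_eq_Suc)
  ultimately show thesis
    using that[OF K] by (simp add: not_le)
qed

text \<open>The bound does not depend on \<open>k\<close>: the steps are dominated by a geometric
  sequence, whose tail from \<open>j\<close> on sums to at most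
  \<open>s j / (1 - p)\<close>.\<close>

lemma norm_diff_le_geometric:
  fixes x :: "nat \<Rightarrow> 'a::real_normed_vector"
  assumes p: "p < 1" and \<tau>: "\<tau> \<ge> 0" and s: "\<And>i. s i \<ge> 0" "\<And>i. s (Suc i) = p * s i"
    and step: "\<And>i. i < k \<Longrightarrow> norm (x (Suc i) - x i) \<le> \<tau> * s i"
    and "j \<le> k"
  shows "norm (x k - x j) \<le> \<tau> / (1 - p) * s j"
proof -
  \<comment> \<open>Keeping \<open>- s k\<close> makes the induction close, since
    \<open>s n = (s n - s (Suc n)) / (1 - p)\<close> telescopes.\<close>
  have "norm (x k - x j) \<le> \<tau> / (1 - p) * (s j - s k)"
    using \<open>j \<le> k\<close> step
  proof (induction k rule: dec_induct)
    case base
    then show ?case by simp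
  next
    case (step n)
    have "norm (x (Suc n) - x j) \<le> norm (x (Suc n) - x n) + norm (x n - x j)"
      using norm_triangle_ineq[of "x (Suc n) - x n" "x n - x j"] by simp
    also have "\<dots> \<le> \<tau> * s n + \<tau> / (1 - p) * (s j - s n)"
      using step by (intro add_mono) simp_all
    also have "\<dots> = \<tau> / (1 - p) * (s j - s (Suc n))"
      using p by (simp add: s(2) field_simps)
    finally show ?case .
  qed
  also have "\<dots> \<le> \<tau> / (1 - p) * s j"
    using p \<tau> s(1)[of k] by (intro mult_left_mono) auto
  finally show ?thesis .
qed

theorem theorem2:
  fixes R :: "real \<Rightarrow> 'y::{real_inner,complete_space} \<Rightarrow> 'x::{real_inner,complete_space}"
    and y :: "real \<Rightarrow> 'y" and x_dag :: 'x
    and \<phi> lam :: "real \<Rightarrow> real"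
    and \<delta>\<^sub>0 \<kappa> K\<^sub>2 q c\<^sub>5 c\<^sub>6 c\<^sub>7 \<tau>\<^sub>L :: real
    and \<alpha>\<^sub>0 :: "real \<Rightarrow> real" and N :: "real \<Rightarrow> nat"
  assumes "\<delta>\<^sub>0 > 0"
    and "index_function \<phi>"
    and "\<kappa> > 0" and "K\<^sub>2 > 0"
    and "\<And>\<alpha>. \<alpha> > 0 \<Longrightarrow> lam \<alpha> = \<alpha> powr \<kappa> / K\<^sub>2"
    and "\<And>\<alpha> \<delta>. \<alpha> > 0 \<Longrightarrow> 0 < \<delta> \<Longrightarrow> \<delta> \<le> \<delta>\<^sub>0 \<Longrightarrow>
           norm (R \<alpha> (y \<delta>) - x_dag) \<le> \<phi> \<alpha> + \<delta> / lam \<alpha>"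
    and "q > 1"
    and "c\<^sub>5 > 0" and "c\<^sub>6 > 0" and "c\<^sub>7 > 0"
    and "\<And>\<delta>. 0 < \<delta> \<Longrightarrow> \<delta> \<le> \<delta>\<^sub>0 \<Longrightarrow> 0 < \<alpha>\<^sub>0 \<delta> \<and> \<alpha>\<^sub>0 \<delta> \<le> c\<^sub>5 * \<delta> powr (1 / \<kappa>)"
    and "\<And>\<delta>. 0 < \<delta> \<Longrightarrow> \<delta> \<le> \<delta>\<^sub>0 \<Longrightarrow>
           c\<^sub>6 \<le> grid_point q (\<alpha>\<^sub>0 \<delta>) (N \<delta>) \<and> grid_point q (\<alpha>\<^sub>0 \<delta>) (N \<delta>) \<le> c\<^sub>7"
    and "\<tau>\<^sub>L > 1 + q powr (- \<kappa>)"
  shows "\<exists>c\<^sub>2>0. \<forall>\<delta>. 0 < \<delta> \<and> \<delta> \<le> \<delta>\<^sub>0 \<longrightarrow>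
           (let \<alpha>s = Max (balancing_set \<tau>\<^sub>L lam \<delta> (\<lambda>\<alpha>. R \<alpha> (y \<delta>)) q (\<alpha>\<^sub>0 \<delta>) (N \<delta>))
            in norm (R \<alpha>s (y \<delta>) - x_dag) \<le> c\<^sub>2 * (INF \<alpha>\<in>{0<..}. \<phi> \<alpha> + \<delta> / lam \<alpha>))"
proof -
  note \<phi> = \<open>index_function \<phi>\<close> and lam = assms(5) and err = assms(6)
    and \<alpha>\<^sub>0 = assms(11) and \<alpha>\<^sub>N = assms(12)
  define p where "p = q powr (- \<kappa>)"
  \<comment> \<open>\<open>\<epsilon>\<close> is the slack in the assumption on
    \<open>\<tau>\<^sub>L\<close>, and \<open>D\<close> adds the error at one grid point to the
    geometric tail. \<open>B\<close> will bound \<open>s\<close> at the first grid point from below,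
    and \<open>E * \<delta>\<close> is \<open>s c\<^sub>6\<close>. \<open>C\<close> has one summand
    for each case in the bound on \<open>s (g K)\<close>. In \<open>c\<close>, each position of
    \<open>\<alpha>\<close> relative to the grid accounts for one of \<open>C\<close>,
    \<open>D / p\<close> and \<open>\<phi> c\<^sub>7 / B + D\<close>.\<close>
  define \<epsilon> where "\<epsilon> = \<tau>\<^sub>L - (1 + p)"
  define D where "D = 1 + \<tau>\<^sub>L / (1 - p)"
  define B where "B = K\<^sub>2 * c\<^sub>5 powr (- \<kappa>)"
  define E where "E = K\<^sub>2 * c\<^sub>6 powr (- \<kappa>)"
  define C where "C = 2 / \<epsilon> + 1 / p + E * \<delta>\<^sub>0 / \<phi> c\<^sub>6 + 1"
  define c where "c = 1 + C + D / p + \<phi> c\<^sub>7 / B + D"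
  have p: "0 < p" "p < 1"
    using \<open>q > 1\<close> \<open>\<kappa> > 0\<close> by (auto simp: p_def powr_less_one)
  have \<epsilon>: "\<epsilon> > 0" using assms(13) by (simp add: \<epsilon>_def p_def)
  have \<tau>: "\<tau>\<^sub>L > 0" using \<epsilon> p by (simp add: \<epsilon>_def)
  have D: "D \<ge> 1" using \<tau> p by (simp add: D_def)
  have B: "B > 0" and E: "E > 0"
    using \<open>K\<^sub>2 > 0\<close> \<open>c\<^sub>5 > 0\<close> \<open>c\<^sub>6 > 0\<close> by (auto simp: B_def E_def)
  have \<phi>_pos: "\<phi> t > 0" if "t > 0" for t
    using \<phi> that by (simp add: index_function_def)
  have \<phi>_mono: "\<phi> a \<le> \<phi> b" if "0 < a" "a \<le> b" for a b
    using \<phi> that by (auto simp: index_function_def mono_on_def)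
  have C_parts: "2 / \<epsilon> \<le> C" "1 / p \<le> C" "E * \<delta>\<^sub>0 / \<phi> c\<^sub>6 \<le> C" "1 \<le> C"
    using \<epsilon> p E \<open>\<delta>\<^sub>0 > 0\<close> \<phi>_pos[OF \<open>c\<^sub>6 > 0\<close>] by (auto simp: C_def intro!: add_nonneg_nonneg)
  have c_nonneg: "0 \<le> C" "0 \<le> D / p" "0 \<le> \<phi> c\<^sub>7 / B" "0 \<le> D"
    using C_parts D p B \<phi>_pos[OF \<open>c\<^sub>7 > 0\<close>] by (auto intro: divide_nonneg_nonneg)
  then have c_parts: "1 + C \<le> c" "1 + D / p \<le> c" "\<phi> c\<^sub>7 / B + D \<le> c" "c > 0"
    by (auto simp: c_def)

  have bound: "norm (R (Max (balancing_set \<tau>\<^sub>L lam \<delta> (\<lambda>\<alpha>. R \<alpha> (y \<delta>)) q (\<alpha>\<^sub>0 \<delta>) (N \<delta>))) (y \<delta>) - x_dag)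
      \<le> c * (\<phi> \<alpha> + \<delta> / lam \<alpha>)"
    if \<delta>: "0 < \<delta>" "\<delta> \<le> \<delta>\<^sub>0" and \<alpha>: "\<alpha> > 0" for \<delta> \<alpha>
  proof -
    define s where "s = (\<lambda>\<alpha>. \<delta> / lam \<alpha>)"
    define g where "g = grid_point q (\<alpha>\<^sub>0 \<delta>)"
    define M where "M = \<phi> \<alpha> + s \<alpha>"
    have s_eq: "s a = K\<^sub>2 * \<delta> * a powr (- \<kappa>)" if "a > 0" for a
      by (simp add: s_def lam[OF that] powr_minus divide_inverse)
    have s_pos: "s a > 0" if "a > 0" for a
      using that \<delta> \<open>K\<^sub>2 > 0\<close> by (simp add: s_eq)
    have s_anti: "s b \<le> s a" if "0 < a" "a \<le> b" for a b
      using that \<delta> \<open>K\<^sub>2 > 0\<close> \<open>\<kappa> > 0\<close> by (auto simp: s_eq intro!: mult_left_mono powr_mono2')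
    have a0: "\<alpha>\<^sub>0 \<delta> > 0" using \<alpha>\<^sub>0[OF \<delta>] by simp
    have g_pos: "g j > 0" for j
      using grid_point_pos[OF _ a0] \<open>q > 1\<close> by (simp add: g_def)
    have g_le: "g i \<le> g j \<longleftrightarrow> i \<le> j" for i j
      using grid_point_le_iff[OF \<open>q > 1\<close> a0] by (simp add: g_def)
    have sg: "s (g (Suc j)) = p * s (g j)" for j
      using g_pos[of j] g_pos[of "Suc j"] \<open>q > 1\<close>
      by (simp add: s_eq p_def g_def grid_point_Suc powr_mult)
    have M: "\<phi> \<alpha> \<le> M" "s \<alpha> \<le> M" "0 < M"
      using \<phi>_pos[OF \<alpha>] s_pos[OF \<alpha>] by (auto simp: M_def)
    obtain K where K: "K \<le> N \<delta>"
      and Max_eq: "Max (balancing_set \<tau>\<^sub>L lam \<delta> (\<lambda>\<alpha>. R \<alpha> (y \<delta>)) q (\<alpha>\<^sub>0 \<delta>) (N \<delta>)) = g K"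
      and pass: "\<And>j. j < K \<Longrightarrow> norm (R (g (Suc j)) (y \<delta>) - R (g j) (y \<delta>)) \<le> \<tau>\<^sub>L * s (g j)"
      and fail: "K < N \<delta> \<Longrightarrow> norm (R (g (Suc K)) (y \<delta>) - R (g K) (y \<delta>)) > \<tau>\<^sub>L * s (g K)"
      using balancing_index_exists[OF \<open>q > 1\<close> a0] unfolding g_def s_def by metis
    have err': "norm (R a (y \<delta>) - x_dag) \<le> \<phi> a + s a" if "a > 0" for a
      using err[OF that \<delta>] by (simp add: s_def)

    have error_le: "norm (R (g K) (y \<delta>) - x_dag) \<le> \<phi> (g j) + D * s (g j)" if "j \<le> K" for j
    proof -
      have "norm (R (g K) (y \<delta>) - R (g j) (y \<delta>)) \<le> \<tau>\<^sub>L / (1 - p) * s (g j)"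
        by (rule norm_diff_le_geometric[where s = "\<lambda>i. s (g i)" and x = "\<lambda>i. R (g i) (y \<delta>)"])
           (use p \<tau> s_pos g_pos sg pass that in \<open>auto simp: less_imp_le\<close>)
      then show ?thesis
        using err'[OF g_pos[of j]]
          norm_triangle_ineq[of "R (g K) (y \<delta>) - R (g j) (y \<delta>)" "R (g j) (y \<delta>) - x_dag"]
        by (simp add: D_def algebra_simps)
    qed

    have sK: "s (g K) \<le> C * M"
    proof (cases "K < N \<delta>")
      case True
      \<comment> \<open>The failing test, with the two approximations compared through
        \<open>x_dag\<close>. Since \<open>s (g (Suc K)) = p * s (g K)\<close>, the noise terms on
        the right use up only \<open>1 + p\<close> of the factor
        \<open>\<tau>\<^sub>L\<close>.\<close>
      have "\<tau>\<^sub>L * s (g K) < (\<phi> (g (Suc K)) + s (g (Suc K))) + (\<phi> (g K) + s (g K))"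
        using fail[OF True] err'[OF g_pos[of "Suc K"]] err'[OF g_pos[of K]]
          norm_triangle_ineq4[of "R (g (Suc K)) (y \<delta>) - x_dag" "R (g K) (y \<delta>) - x_dag"]
        by simp
      moreover have "\<phi> (g K) \<le> \<phi> (g (Suc K))"
        by (intro \<phi>_mono) (auto simp: g_pos g_le)
      ultimately have \<phi>_large: "\<epsilon> * s (g K) \<le> 2 * \<phi> (g (Suc K))"
        by (simp add: \<epsilon>_def sg algebra_simps)
      show ?thesis
      proof (cases "\<alpha> \<le> g (Suc K)")
        case True
        \<comment> \<open>Here the noise term at \<open>\<alpha>\<close> suffices; beyond
          \<open>g (Suc K)\<close> the failed test makes \<open>\<phi> \<alpha>\<close> large
          instead.\<close>
        then have "s (g K) \<le> 1 / p * s \<alpha>"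
          using s_anti[OF \<alpha> True] p by (simp add: sg field_simps)
        also have "\<dots> \<le> C * M"
          using C_parts M p s_pos[OF \<alpha>] by (intro mult_mono) auto
        finally show ?thesis .
      next
        case False
        then have "\<phi> (g (Suc K)) \<le> \<phi> \<alpha>"
          by (intro \<phi>_mono) (auto simp: g_pos)
        with \<phi>_large have "s (g K) \<le> 2 / \<epsilon> * \<phi> \<alpha>"
          using \<epsilon> by (simp add: field_simps)
        also have "\<dots> \<le> C * M"
          using C_parts M \<epsilon> \<phi>_pos[OF \<alpha>] by (intro mult_mono) auto
        finally show ?thesis .
      qed
    next
      case False
      then have "c\<^sub>6 \<le> g K"
        using K \<alpha>\<^sub>N[OF \<delta>] by (simp add: g_def)
      then have 1: "s (g K) \<le> s c\<^sub>6"
        using \<open>c\<^sub>6 > 0\<close> by (intro s_anti)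
      show ?thesis
      proof (cases "\<alpha> \<le> c\<^sub>6")
        case True
        then have "s (g K) \<le> 1 * M"
          using 1 s_anti[OF \<alpha> True] M by simp
        also have "\<dots> \<le> C * M"
          using C_parts M by (intro mult_right_mono) auto
        finally show ?thesis .
      next
        case False
        \<comment> \<open>For \<open>\<alpha>\<close> beyond \<open>c\<^sub>6\<close> the noise term
          may be tiny, but \<open>\<phi> \<alpha>\<close> is at least the fixed positive number
          \<open>\<phi> c\<^sub>6\<close>. This is where the constant comes to depend on
          \<open>\<phi>\<close> and \<open>\<delta>\<^sub>0\<close>.\<close>
        have "s c\<^sub>6 \<le> E * \<delta>\<^sub>0"
          using mult_left_mono[OF \<delta>(2), of E] E \<open>c\<^sub>6 > 0\<close> by (simp add: s_eq E_def mult_ac)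
        also have "\<dots> = E * \<delta>\<^sub>0 / \<phi> c\<^sub>6 * \<phi> c\<^sub>6"
          using \<phi>_pos[OF \<open>c\<^sub>6 > 0\<close>] by simp
        also have "\<dots> \<le> C * M"
          using C_parts M \<phi>_mono[of c\<^sub>6 \<alpha>] \<phi>_pos[OF \<open>c\<^sub>6 > 0\<close>] \<open>c\<^sub>6 > 0\<close> False
          by (intro mult_mono) auto
        finally show ?thesis using 1 by simp
      qed
    qed

    have "norm (R (g K) (y \<delta>) - x_dag) \<le> c * M"
    proof -
      consider "g K \<le> \<alpha>" | "\<alpha> < g 0" | "g 0 \<le> \<alpha>" "\<alpha> < g K"
        by linarith
      then show ?thesis
      proof cases
        case 1
        then have "\<phi> (g K) \<le> \<phi> \<alpha>"
          by (intro \<phi>_mono g_pos)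
        then have "norm (R (g K) (y \<delta>) - x_dag) \<le> (1 + C) * M"
          using err'[OF g_pos[of K]] sK M by (simp add: distrib_right)
        also have "\<dots> \<le> c * M"
          using c_parts M by (intro mult_right_mono) auto
        finally show ?thesis .
      next
        case 2
        have s0: "s (g 0) \<le> s \<alpha>"
          using 2 \<alpha> by (intro s_anti) auto
        \<comment> \<open>The power \<open>1 / \<kappa>\<close> is chosen so that
          \<open>\<delta>\<close> cancels: \<open>s (g 0)\<close> stays above \<open>B\<close> for
          all noise levels. Hence it absorbs \<open>\<phi> (g 0)\<close>, which is at most
          \<open>\<phi> c\<^sub>7\<close>.\<close>
        have "(c\<^sub>5 * \<delta> powr (1 / \<kappa>)) powr (- \<kappa>) \<le> g 0 powr (- \<kappa>)"
          using \<alpha>\<^sub>0[OF \<delta>] \<open>\<kappa> > 0\<close> by (intro powr_mono2') (auto simp: g_def)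
        also have "(c\<^sub>5 * \<delta> powr (1 / \<kappa>)) powr (- \<kappa>) = c\<^sub>5 powr (- \<kappa>) / \<delta>"
          using \<delta> \<open>c\<^sub>5 > 0\<close> \<open>\<kappa> > 0\<close> by (simp add: powr_mult powr_powr powr_minus divide_simps)
        finally have "B \<le> s (g 0)"
          using \<delta> \<open>K\<^sub>2 > 0\<close> g_pos[of 0] by (simp add: B_def s_eq field_simps)
        moreover have "g 0 \<le> c\<^sub>7"
          using g_le[of 0 "N \<delta>"] \<alpha>\<^sub>N[OF \<delta>] by (simp add: g_def)
        then have "\<phi> (g 0) \<le> \<phi> c\<^sub>7 / B * B"
          using \<phi>_mono[OF g_pos] B by simp
        ultimately have "\<phi> (g 0) \<le> \<phi> c\<^sub>7 / B * s (g 0)"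
          using c_nonneg(3) by (meson mult_left_mono order_trans)
        then have "norm (R (g K) (y \<delta>) - x_dag) \<le> (\<phi> c\<^sub>7 / B + D) * s (g 0)"
          using error_le[of 0] by (simp add: distrib_right)
        also have "\<dots> \<le> c * M"
          using c_parts c_nonneg s0 M s_pos[OF g_pos[of 0]] by (intro mult_mono) auto
        finally show ?thesis .
      next
        case 3
        \<comment> \<open>\<open>Suc j\<close> is the first grid index beyond
          \<open>\<alpha>\<close>. Passing from \<open>g (Suc j)\<close> back to \<open>g j\<close>
          costs the factor \<open>1 / p\<close> in the noise term.\<close>
        then obtain j where j: "j < K" "g j \<le> \<alpha>" "\<alpha> < g (Suc j)"
          using ex_least_nat_less[of "\<lambda>j. \<alpha> < g j" K] by (auto simp: not_less)
        have "p * s (g j) \<le> s \<alpha>"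
          using s_anti[of \<alpha> "g (Suc j)"] j \<alpha> by (simp add: sg)
        then have "s (g j) \<le> s \<alpha> / p"
          using p by (simp add: field_simps)
        also have "\<dots> \<le> M / p"
          using M p by (intro divide_right_mono) auto
        finally have "D * s (g j) \<le> D * (M / p)"
          using D by (intro mult_left_mono) auto
        moreover have "\<phi> (g j) \<le> \<phi> \<alpha>"
          using j by (intro \<phi>_mono g_pos)
        ultimately have "norm (R (g K) (y \<delta>) - x_dag) \<le> (1 + D / p) * M"
          using error_le[of j] j M by (simp add: distrib_right)
        also have "\<dots> \<le> c * M"
          using c_parts M by (intro mult_right_mono) auto
        finally show ?thesis .
      qed
    qed
    then show ?thesis
      by (simp only: Max_eq M_def s_def)
  qed

  show ?thesis
  proof (intro exI[of _ c] conjI allI impI)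
    show "c > 0" by (rule c_parts)
    fix \<delta> assume \<delta>: "0 < \<delta> \<and> \<delta> \<le> \<delta>\<^sub>0"
    let ?e = "norm (R (Max (balancing_set \<tau>\<^sub>L lam \<delta> (\<lambda>\<alpha>. R \<alpha> (y \<delta>)) q (\<alpha>\<^sub>0 \<delta>) (N \<delta>))) (y \<delta>) - x_dag)"
    \<comment> \<open>\<open>c\<close> was fixed before \<delta> and \<alpha>, so after division by
      it the left side is a lower bound for every value under the infimum.\<close>
    have "?e / c \<le> (INF \<alpha>\<in>{0<..}. \<phi> \<alpha> + \<delta> / lam \<alpha>)"
      using bound \<delta> c_parts(4)
      by (intro cINF_greatest) (auto simp: divide_le_eq mult.commute)
    then show "let \<alpha>s = Max (balancing_set \<tau>\<^sub>L lam \<delta> (\<lambda>\<alpha>. R \<alpha> (y \<delta>)) q (\<alpha>\<^sub>0 \<delta>) (N \<delta>))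
        in norm (R \<alpha>s (y \<delta>) - x_dag) \<le> c * (INF \<alpha>\<in>{0<..}. \<phi> \<alpha> + \<delta> / lam \<alpha>)"
      using c_parts(4) by (simp add: Let_def divide_le_eq mult.commute)
  qed
qed

end
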